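(* Let $\alpha=\alpha_1\cdots\alpha_n$ and $\beta=\beta_1\cdots\beta_n$ be two words of positive integers on which the SR algorithm does not terminate. If $\mathrm{shape}(R(\alpha))=\mathrm{shape}(R(\beta))$, then $s_{\alpha_1}s_{\alpha_2}\cdots s_{\alpha_n}=s_{\beta_1}s_{\beta_2}\cdots s_{\beta_n}$ as permutations.
   Context: $s_i$ denotes the adjacent transposition $(i,i+1)$ of the positive integers. A cell is a pair $(i,j)$ of integers with $i\ge 1$, $j\ge 0$. A tower diagram is a finite set $\mathcal T$ of cells such that $(i,j)\in\mathcal T$ and $0\le k\le j$ imply $(i,k)\in\mathcal T$. The cell $(i,j)$ lies on the diagonal $x+y=i+j$. Sliding: for a positive integer $\alpha$, $\alpha^{\searrow}\mathcal T$ is computed by the procedure $P(\gamma,m)$ started at $\gamma=\alpha$, $m=1$: (S1) if no cell $(i,j)\in\mathcal T$ with $i\ge m$ lies on $x+y=\gamma-1$: (a) if $(\gamma,0)\notin\mathcal T$ the result is $\mathcal T\cup\{(\gamma,0)\}$; (b) if $(\gamma,0)\in\mathcal T$, $(\gamma,1)\notin\mathcal T$ the slide terminates (without result); (c) if $(\gamma,0),(\gamma,1)\in\mathcal T$, continue with $P(\gamma+1,\gamma+1)$. (S2) Otherwise let $i\ge m$ be smallest with $(i,\gamma-1-i)\in\mathcal T$: (a) if $(i,\gamma-i)\notin\mathcal T$ the result is $\mathcal T\cup\{(i,\gamma-i)\}$; (b) if $(i,\gamma-i)\in\mathcal T$, $(i,\gamma-i+1)\notin\mathcal T$ the slide terminates;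 (c) if both are in $\mathcal T$, continue with $P(\gamma+1,i+1)$. SR algorithm: for a word $\alpha=\alpha_1\cdots\alpha_n$, set $\mathcal T^{(0)}=\varnothing$, $\mathcal T^{(k)}=\alpha_k^{\searrow}\mathcal T^{(k-1)}$; if some slide terminates, the algorithm terminates. Otherwise $\mathcal T^{(k)}=\mathcal T^{(k-1)}\cup\{d_k\}$, the recording tableau $R(\alpha)$ labels $d_k$ by $k$, and $\mathrm{shape}(R(\alpha))=\mathcal T^{(n)}$. *)

theory Defs
  imports "HOL-Combinatorics.Combinatorics"
begin

text \<open>A cell \<open>(i, j)\<close> sits in column \<open>i \<ge> 1\<close> at height \<open>j \<ge> 0\<close>, on the diagonal \<open>x + y = i + j\<close>.\<close>

type_synonym cell = "nat \<times> nat"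

definition tower_diagram :: "cell set \<Rightarrow> bool" where
  "tower_diagram T \<longleftrightarrow>
     finite T \<and> (\<forall>(i, j)\<in>T. 1 \<le> i) \<and> (\<forall>i j k. (i, j) \<in> T \<and> k \<le> j \<longrightarrow> (i, k) \<in> T)"

text \<open>
  The columns \<open>i \<ge> m\<close> in which \<open>T\<close> has a cell on the diagonal \<open>x + y = g - 1\<close>.  The condition
  \<open>i < g\<close> says that the height \<open>g - 1 - i\<close> is nonnegative; without it the truncated
  subtraction on the naturals would give wrong cells.
\<close>

definition diag_cols :: "cell set \<Rightarrow> nat \<Rightarrow> nat \<Rightarrow> nat set" where
  "diag_cols T g m = {i. m \<le> i \<and> i < g \<and> (i, g - 1 - i) \<in> T}"

lemma card_above_less:
  fixes c :: cell
  assumes "finite T" "c \<in> T" "fst c + snd c = g"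
  shows "card {c \<in> T. g + 1 \<le> fst c + snd c} < card {c \<in> T. g \<le> fst c + snd c}"
proof (rule psubset_card_mono)
  have "c \<in> {c \<in> T. g \<le> fst c + snd c}" "c \<notin> {c \<in> T. g + 1 \<le> fst c + snd c}"
    using assms by auto
  then show "{c \<in> T. g + 1 \<le> fst c + snd c} \<subset> {c \<in> T. g \<le> fst c + snd c}"
    by fastforce
qed (use assms in simp)

text \<open>
  The sliding procedure \<open>P(g, m)\<close>.  The value \<open>Some d\<close> means that the slide yields \<open>T \<union> {d}\<close>,
  and \<open>None\<close> that it terminates without result.  The finiteness test only makes the recursion
  well-founded on arbitrary sets of cells (every tower diagram is finite).
\<close>

function slide_from :: "cell set \<Rightarrow> nat \<Rightarrow> nat \<Rightarrow> cell option" where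
  "slide_from T g m =
     (if infinite T then None
      else if diag_cols T g m = {} then
        (if (g, 0) \<notin> T then Some (g, 0)
         else if (g, 1) \<notin> T then None
         else slide_from T (g + 1) (g + 1))
      else
        (let i = (LEAST i. i \<in> diag_cols T g m) in
         if (i, g - i) \<notin> T then Some (i, g - i)
         else if (i, g - i + 1) \<notin> T then None
         else slide_from T (g + 1) (i + 1)))"
  by pat_completeness auto
termination
proof (relation "measure (\<lambda>(T, g, m). card {c \<in> T. g \<le> fst c + snd c})", goal_cases)
  case 1
  show ?case by simp
next
  case (2 T g m)
  then have "card {c \<in> T. g + 1 \<le> fst c + snd c} < card {c \<in> T. g \<le> fst c + snd c}"
    by (intro card_above_less[where c = "(g, 0)"]) simp_all
  then show ?case by simp
next
  case (3 T g m i)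
  then have "i \<in> diag_cols T g m"
    by (metis LeastI ex_in_conv)
  then have "i < g" by (simp add: diag_cols_def)
  have "card {c \<in> T. g + 1 \<le> fst c + snd c} < card {c \<in> T. g \<le> fst c + snd c}"
    using 3(1,4) \<open>i < g\<close> by (intro card_above_less[where c = "(i, g - i)"]) simp_all
  then show ?case by simp
qed

declare slide_from.simps [simp del]

definition slide :: "nat \<Rightarrow> cell set \<Rightarrow> cell option" where
  "slide a T = slide_from T a 1"

text \<open>
  A labelled diagram is a partial map from cells to labels.  The recording tableau is \<open>None\<close>
  exactly when the SR algorithm terminates.  In \<open>record_from R k w\<close> the word \<open>w\<close> is still to be
  read and its first letter gets the label \<open>k\<close>.
\<close>

type_synonym tableau = "cell \<Rightarrow> nat option"

definition shape :: "tableau \<Rightarrow> cell set" where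
  "shape R = dom R"

primrec record_from :: "tableau \<Rightarrow> nat \<Rightarrow> nat list \<Rightarrow> tableau option" where
  "record_from R k [] = Some R"
| "record_from R k (a # w) =
     (case slide a (shape R) of
        None \<Rightarrow> None
      | Some d \<Rightarrow> record_from (R(d \<mapsto> k)) (k + 1) w)"

definition recording_tableau :: "nat list \<Rightarrow> tableau option" where
  "recording_tableau w = record_from Map.empty 1 w"

text \<open>
  Permutations of the positive integers are represented as functions on \<^typ>\<open>nat\<close>; words of
  positive letters fix \<open>0\<close>.  Products are composed as functions, the rightmost factor acting first.
\<close>

definition adj_transp :: "nat \<Rightarrow> nat \<Rightarrow> nat" where
  "adj_transp i = transpose i (i + 1)"

definition word_perm :: "nat list \<Rightarrow> nat \<Rightarrow> nat" where
  "word_perm w = foldr (\<lambda>i p. adj_transp i \<circ> p) w id"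

text \<open>Sliding a positive letter turns tower diagrams into tower diagrams.\<close>

lemma tower_diagram_insert:
  assumes "tower_diagram T" "1 \<le> i" "\<And>k. k < j \<Longrightarrow> (i, k) \<in> T"
  shows "tower_diagram (insert (i, j) T)"
  unfolding tower_diagram_def
proof (intro conjI allI impI)
  show "finite (insert (i, j) T)" "\<forall>(i', j')\<in>insert (i, j) T. 1 \<le> i'"
    using assms(1,2) by (auto simp only: tower_diagram_def finite_insert insert_iff prod.case Ball_def split: prod.splits)
next
  fix a b k assume "(a, b) \<in> insert (i, j) T \<and> k \<le> b"
  then consider "a = i" "b = j" "k = j" | "a = i" "b = j" "k < j" | "(a, b) \<in> T" "k \<le> b"
    by force
  then show "(a, k) \<in> insert (i, j) T"
  proof cases
    case 3
    with assms(1) show ?thesis unfolding tower_diagram_def by blast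
  qed (use assms(3) in auto)
qed

lemma slide_from_tower_diagram:
  assumes "slide_from T g m = Some d" "tower_diagram T" "1 \<le> g" "1 \<le> m"
  shows "d \<notin> T \<and> tower_diagram (insert d T)"
  using assms
proof (induction T g m rule: slide_from.induct)
  case (1 T g m)
  have fin: "\<not> infinite T" using 1(4) unfolding tower_diagram_def by blast
  have eq: "slide_from T g m = Some d" by (fact 1(3))
  show ?case
  proof (cases "diag_cols T g m = {}")
    case True
    show ?thesis
    proof (cases "(g, 0) \<in> T")
      case False
      have "d = (g, 0)" using eq True False fin by (subst (asm) slide_from.simps) simp
      with 1(4,5) False show ?thesis by (simp add: tower_diagram_insert)
    next
      case t: True
      have t1: "\<not> (g, 1) \<notin> T" using eq True t fin by (subst (asm) slide_from.simps) (auto split: if_splits)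
      have "slide_from T (g + 1) (g + 1) = Some d"
        using eq True t t1 fin by (subst (asm) slide_from.simps) simp
      then show ?thesis using 1(1)[OF fin True _ t1] t 1(4) by simp
    qed
  next
    case False
    define i where "i = (LEAST i. i \<in> diag_cols T g m)"
    have "i \<in> diag_cols T g m" unfolding i_def using False by (metis LeastI ex_in_conv)
    then have i: "(i, g - 1 - i) \<in> T" "i < g" "m \<le> i" by (auto simp: diag_cols_def)
    have eq': "(if (i, g - i) \<notin> T then Some (i, g - i)
         else if (i, g - i + 1) \<notin> T then None
         else slide_from T (g + 1) (i + 1)) = Some d"
      using eq False fin unfolding i_def by (subst (asm) slide_from.simps) (simp add: Let_def)
    show ?thesis
    proof (cases "(i, g - i) \<in> T")
      case F: False
      then have d: "d = (i, g - i)" using eq' by simp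
      have "(i, k) \<in> T" if "k < g - i" for k
      proof -
        have "k \<le> g - 1 - i" using that by simp
        with i(1) 1(4) show ?thesis unfolding tower_diagram_def by blast
      qed
      with F 1(4,6) i(3) show ?thesis unfolding d by (simp add: tower_diagram_insert)
    next
      case t: True
      have t1: "\<not> (i, g - i + 1) \<notin> T" using eq' t by (simp split: if_splits)
      have "slide_from T (g + 1) (i + 1) = Some d" using eq' t t1 by simp
      then show ?thesis using 1(2)[OF fin False i_def _ t1] t 1(4) by simp
    qed
  qed
qed

lemma tower_diagram_record_from:
  assumes "record_from R k w = Some R'" "\<forall>a\<in>set w. 1 \<le> a" "tower_diagram (shape R)"
  shows "tower_diagram (shape R')"
  using assms
proof (induction w arbitrary: R k)
  case (Cons a w)
  obtain d where d: "slide a (shape R) = Some d" "record_from (R(d \<mapsto> k)) (k + 1) w = Some R'"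
    using Cons.prems(1) by (auto split: option.splits)
  have tower: "tower_diagram (shape (R(d \<mapsto> k)))"
    using slide_from_tower_diagram[of "shape R" a 1 d] d(1) Cons.prems(2,3)
    by (simp add: slide_def shape_def)
  show ?case using Cons.IH[OF d(2) _ tower] Cons.prems(2) by simp
qed simp

lemma tower_diagram_shape:
  assumes "recording_tableau w = Some R" "\<forall>a\<in>set w. 1 \<le> a"
  shows "tower_diagram (shape R)"
  using assms tower_diagram_record_from[of Map.empty 1 w R]
  by (simp add: recording_tableau_def shape_def tower_diagram_def)

end

(*
  Column i of height h of a tower diagram spells the word i, i+1, ..., i+h-1, and the whole
  diagram spells the concatenation of its columns from right to left.  Sliding the letter a
  into T computes the product of this word with s_a: the procedure P(g, m) moves s_g leftwards
  through the columns m, m+1, ..., using commutation when a column stays below the diagonal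
  g - 1, lengthening a column that ends exactly there, and using the braid relation, which
  turns s_g into s_(g+1), when the column reaches the diagonal g + 1.  Hence the permutation
  of a word is the one spelled by its shape.
*)

theory Submission
  imports Defs
begin

section \<open>Products of adjacent transpositions\<close>

lemma word_perm_simps [simp]:
  "word_perm [] = id"
  "word_perm (a # w) = adj_transp a \<circ> word_perm w"
  by (simp_all add: word_perm_def)

lemma word_perm_append [simp]: "word_perm (v @ w) = word_perm v \<circ> word_perm w"
  by (induction v) (simp_all add: comp_assoc)

lemma adj_transp_commute:
  assumes "i + 2 \<le> j \<or> j + 2 \<le> i"
  shows "adj_transp i \<circ> adj_transp j = adj_transp j \<circ> adj_transp i"
  using assms by (auto simp: adj_transp_def transpose_def fun_eq_iff)

lemma adj_transp_braid:
  "adj_transp i \<circ> adj_transp (Suc i) \<circ> adj_transp i =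
   adj_transp (Suc i) \<circ> adj_transp i \<circ> adj_transp (Suc i)"
  by (auto simp: adj_transp_def transpose_def fun_eq_iff)

lemma word_perm_commute:
  assumes "\<forall>a\<in>set w. a + 2 \<le> g \<or> g + 2 \<le> a"
  shows "word_perm w \<circ> adj_transp g = adj_transp g \<circ> word_perm w"
  using assms
proof (induction w)
  case (Cons a w)
  then have IH: "word_perm w \<circ> adj_transp g = adj_transp g \<circ> word_perm w" by (simp add: comp_def)
  have "word_perm (a # w) \<circ> adj_transp g = adj_transp a \<circ> (word_perm w \<circ> adj_transp g)"
    by (simp add: comp_assoc)
  also have "\<dots> = (adj_transp a \<circ> adj_transp g) \<circ> word_perm w"
    by (simp only: IH comp_assoc)
  also have "\<dots> = adj_transp g \<circ> word_perm (a # w)"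
    using adj_transp_commute[of a g] Cons.prems by (simp add: comp_assoc)
  finally show ?case .
qed simp

text \<open>The letters below \<open>g\<close> commute with \<open>s_(g+1)\<close> and those above
  \<open>g + 1\<close> commute with \<open>s_g\<close>, so the claim reduces to the braid relation
  on \<open>g\<close>, \<open>g + 1\<close>. Both of these letters must occur in the
  interval.\<close>

lemma word_perm_upt_shift:
  assumes "i \<le> g" "g + 2 \<le> k"
  shows "word_perm [i..<k] \<circ> adj_transp g = adj_transp (Suc g) \<circ> word_perm [i..<k]"
proof -
  let ?s = adj_transp and ?u = "word_perm [i..<g]" and ?v = "word_perm [g + 2..<k]"
  have "[i..<k] = [i..<g] @ [g, Suc g] @ [g + 2..<k]"
    using assms upt_add_eq_append[of i g "k - g"] by (simp add: upt_conv_Cons)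
  then have split: "word_perm [i..<k] = ?u \<circ> ?s g \<circ> ?s (Suc g) \<circ> ?v"
    by (simp add: comp_assoc)
  have u: "?u \<circ> ?s (Suc g) = ?s (Suc g) \<circ> ?u" and v: "?v \<circ> ?s g = ?s g \<circ> ?v"
    by (auto intro!: word_perm_commute)
  have "word_perm [i..<k] \<circ> ?s g = ?u \<circ> (?s g \<circ> ?s (Suc g) \<circ> ?s g) \<circ> ?v"
    using v by (simp add: split comp_assoc)
  also have "\<dots> = (?u \<circ> ?s (Suc g)) \<circ> ?s g \<circ> ?s (Suc g) \<circ> ?v"
    unfolding adj_transp_braid by (simp only: comp_assoc)
  also have "\<dots> = ?s (Suc g) \<circ> word_perm [i..<k]"
    unfolding u split by (simp only: comp_assoc)
  finally show ?thesis .
qed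

section \<open>Columns and the word spelled by a diagram\<close>

definition height :: "cell set \<Rightarrow> nat \<Rightarrow> nat" where
  "height T i = card {j. (i, j) \<in> T}"

definition column_word :: "cell set \<Rightarrow> nat \<Rightarrow> nat list" where
  "column_word T i = [i..<i + height T i]"

text \<open>The range starts at \<open>m\<close> because \<open>P(g, m)\<close> only looks at
  columns from \<open>m\<close> on. The reversal puts column \<open>m\<close> last, so a factor
  multiplied on the right meets it first.\<close>

definition tower_word :: "cell set \<Rightarrow> nat \<Rightarrow> nat \<Rightarrow> nat list" where
  "tower_word T m n = concat (map (column_word T) (rev [m..<n]))"

lemma finite_column: "finite T \<Longrightarrow> finite {j. (i, j) \<in> T}"
  by (rule finite_subset[of _ "snd ` T"]) force+

text \<open>A column is a finite downward closed set of naturals, hence an initial segment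
  determined by its cardinality.\<close>

lemma mem_tower_diagram_iff:
  assumes "tower_diagram T"
  shows "(i, j) \<in> T \<longleftrightarrow> j < height T i"
proof -
  let ?C = "{j. (i, j) \<in> T}"
  have fin: "finite ?C" using assms unfolding tower_diagram_def by (intro finite_column) blast
  have down: "k \<in> ?C" if "j \<in> ?C" "k \<le> j" for j k
    using assms that unfolding tower_diagram_def by blast
  show ?thesis
  proof
    assume "(i, j) \<in> T"
    then have "{..j} \<subseteq> ?C" using down by blast
    from card_mono[OF fin this] show "j < height T i" by (simp add: height_def)
  next
    assume less: "j < height T i"
    show "(i, j) \<in> T"
    proof (rule ccontr)
      assume "(i, j) \<notin> T"
      then have "l < j" if "l \<in> ?C" for l
        using down[OF that, of j] by (cases "l < j") auto
      then have "?C \<subseteq> {..<j}" by blast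
      from card_mono[OF _ this] less show False by (simp add: height_def)
    qed
  qed
qed

lemma height_insert:
  assumes "finite T" "(i, j) \<notin> T"
  shows "height (insert (i, j) T) k = (if k = i then Suc (height T i) else height T k)"
proof -
  have "{l. (i, l) \<in> insert (i, j) T} = insert j {l. (i, l) \<in> T}" by auto
  then show ?thesis using assms finite_column[of T i] by (auto simp: height_def)
qed

lemma tower_word_cong:
  assumes "\<And>i. m \<le> i \<Longrightarrow> i < n \<Longrightarrow> height S i = height T i"
  shows "tower_word S m n = tower_word T m n"
  using assms by (auto simp: tower_word_def column_word_def intro!: arg_cong[where f = concat])

lemma tower_word_split:
  assumes "m \<le> i" "i < n"
  shows "tower_word T m n = tower_word T (Suc i) n @ column_word T i @ tower_word T m i"
proof -
  have "[m..<n] = [m..<i] @ i # [Suc i..<n]"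
    using assms upt_add_eq_append[of m i "n - i"] by (simp add: upt_conv_Cons)
  then show ?thesis by (simp add: tower_word_def)
qed

section \<open>The effect of a slide on the permutation\<close>

text \<open>
  Column \<open>i\<close> is the first one from \<open>m\<close> on whose word does not commute past \<open>g\<close>; taking
  \<open>i = g\<close> in step (S1) makes (S1) and (S2) instances of a single rule.
\<close>

lemma slide_from_step:
  assumes T: "tower_diagram T" and "m \<le> g"
  obtains i where "m \<le> i" "i \<le> g" "\<And>k. m \<le> k \<Longrightarrow> k < i \<Longrightarrow> k + height T k < g"
    "g \<le> i + height T i"
    "slide_from T g m =
       (if height T i = g - i then Some (i, g - i)
        else if height T i = Suc (g - i) then None
        else slide_from T (Suc g) (Suc i))"
proof (cases "diag_cols T g m = {}")
  case True
  have "k + height T k < g" if "m \<le> k" "k < g" for k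
    using True that by (auto simp: diag_cols_def mem_tower_diagram_iff[OF T])
  moreover have "slide_from T g m =
      (if height T g = g - g then Some (g, g - g)
       else if height T g = Suc (g - g) then None
       else slide_from T (Suc g) (Suc g))"
    using True T
    by (subst slide_from.simps) (auto simp: mem_tower_diagram_iff[OF T] tower_diagram_def)
  ultimately show ?thesis using \<open>m \<le> g\<close> by (intro that[of g]) auto
next
  case False
  define i where "i = (LEAST i. i \<in> diag_cols T g m)"
  have "i \<in> diag_cols T g m" unfolding i_def using False by (metis LeastI ex_in_conv)
  then have i: "m \<le> i" "i < g" "g \<le> i + height T i"
    by (auto simp: diag_cols_def mem_tower_diagram_iff[OF T])
  have below: "k + height T k < g" if "m \<le> k" "k < i" for k
  proof -
    have "k \<notin> diag_cols T g m" using that(2) not_less_Least unfolding i_def by blast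
    then show ?thesis using that i(2) by (auto simp: diag_cols_def mem_tower_diagram_iff[OF T])
  qed
  have "slide_from T g m =
      (if height T i = g - i then Some (i, g - i)
       else if height T i = Suc (g - i) then None
       else slide_from T (Suc g) (Suc i))"
    using False T i
    by (subst slide_from.simps)
      (auto simp: mem_tower_diagram_iff[OF T] tower_diagram_def Let_def i_def[symmetric])
  with i below show ?thesis by (intro that[of i]) auto
qed

text \<open>The procedure only moves to the right, so a column that it has passed keeps its
  word.\<close>

lemma slide_from_fst_ge:
  assumes "slide_from T g m = Some d" "tower_diagram T" "m \<le> g"
  shows "m \<le> fst d"
  using assms
\<comment> \<open>The measure counts the cells on or above diagonal \<open>g\<close>. Recursion
  happens only if \<open>(i, g - i)\<close> is in \<open>T\<close>, and this cell is lost when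
  \<open>g\<close> becomes \<open>Suc g\<close>.\<close>
proof (induction "card {c \<in> T. g \<le> fst c + snd c}" arbitrary: g m rule: less_induct)
  case less
  obtain i where i: "m \<le> i" "i \<le> g" "g \<le> i + height T i"
    and eq: "slide_from T g m =
       (if height T i = g - i then Some (i, g - i)
        else if height T i = Suc (g - i) then None
        else slide_from T (Suc g) (Suc i))"
    using slide_from_step[OF less.prems(2,3)] by metis
  show ?case
  proof (cases "height T i = g - i")
    case False
    have "finite T" using less.prems(2) by (simp add: tower_diagram_def)
    moreover have "(i, g - i) \<in> T"
      using False i mem_tower_diagram_iff[OF less.prems(2)] by simp
    ultimately have "card {c \<in> T. Suc g \<le> fst c + snd c} < card {c \<in> T. g \<le> fst c + snd c}"
      using card_above_less[of T "(i, g - i)" g] i by simp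
    from less.hyps[OF this _ less.prems(2), of "Suc i"] False eq less.prems(1) i
    show ?thesis by (simp split: if_splits)
  qed (use eq less.prems(1) i in auto)
qed

text \<open>Stated for every \<open>m\<close>, so that after the braid step the induction hypothesis
  applies to the columns right of \<open>i\<close> with letter \<open>Suc g\<close>.\<close>

lemma word_perm_tower_word_slide_from:
  assumes "slide_from T g m = Some d" "tower_diagram T" "1 \<le> m" "m \<le> g"
    and "\<forall>c\<in>insert d T. fst c < n"
  shows "word_perm (tower_word (insert d T) m n) = word_perm (tower_word T m n) \<circ> adj_transp g"
  using assms
proof (induction "card {c \<in> T. g \<le> fst c + snd c}" arbitrary: g m rule: less_induct)
  case less
  note T = less.prems(2)
  have fin: "finite T" using T by (simp add: tower_diagram_def)
  have new: "d \<notin> T"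
    using slide_from_tower_diagram[OF less.prems(1) T] less.prems(3,4) by simp
  obtain i where i: "m \<le> i" "i \<le> g" "g \<le> i + height T i"
    and below: "\<And>k. m \<le> k \<Longrightarrow> k < i \<Longrightarrow> k + height T k < g"
    and eq: "slide_from T g m =
       (if height T i = g - i then Some (i, g - i)
        else if height T i = Suc (g - i) then None
        else slide_from T (Suc g) (Suc i))"
    using slide_from_step[OF T less.prems(4)] by metis
  let ?s = adj_transp
  let ?L = "\<lambda>S. word_perm (tower_word S (Suc i) n)"
    and ?C = "\<lambda>S. word_perm (column_word S i)"
    and ?R = "\<lambda>S. word_perm (tower_word S m i)"
  \<comment> \<open>By \<open>below\<close>, every letter of the columns from \<open>m\<close> to
    \<open>i - 1\<close> is at most \<open>g - 2\<close>.\<close>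
  have commute: "?R T \<circ> ?s g = ?s g \<circ> ?R T"
    using below by (intro word_perm_commute) (fastforce simp: tower_word_def column_word_def)
  have height_new: "height (insert d T) k = (if k = fst d then Suc (height T k) else height T k)"
    for k using height_insert[OF fin, of "fst d" "snd d" k] new by simp
  show ?case
  proof (cases "height T i = g - i")
    case True
    then have d: "d = (i, g - i)" using eq less.prems(1) by simp
    then have "i < n" using less.prems(5) by simp
    note split = tower_word_split[OF i(1) this]
    have "?L (insert d T) = ?L T" "?R (insert d T) = ?R T"
      by (auto simp: d height_new[unfolded d] intro!: arg_cong[where f = word_perm] tower_word_cong)
    \<comment> \<open>Here \<open>i + height T i = g\<close>, so the longer column word has exactly
      the extra last letter \<open>g\<close>.\<close>
    moreover have "?C (insert d T) = ?C T \<circ> ?s g"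
      using True i(2) by (simp add: column_word_def d height_new[unfolded d])
    ultimately show ?thesis by (simp add: split commute comp_assoc)
  next
    case False
    \<comment> \<open>The column top \<open>i + height T i\<close> is at least \<open>g\<close> but
      neither \<open>g\<close> nor \<open>g + 1\<close>, so both \<open>g\<close> and
      \<open>g + 1\<close> are letters of the column.\<close>
    then have rec: "slide_from T (Suc g) (Suc i) = Some d" and h: "g + 2 \<le> i + height T i"
      using eq less.prems(1) i by (auto split: if_splits)
    have mem: "(i, g - i) \<in> T" using h i mem_tower_diagram_iff[OF T] by simp
    then have "i < n" using less.prems(5) by auto
    note split = tower_word_split[OF i(1) this]
    have "i < fst d" using slide_from_fst_ge[OF rec T] i by simp
    then have same: "?R (insert d T) = ?R T" "?C (insert d T) = ?C T"
      by (auto simp: height_new column_word_def intro!: arg_cong[where f = word_perm] tower_word_cong)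
    have "card {c \<in> T. Suc g \<le> fst c + snd c} < card {c \<in> T. g \<le> fst c + snd c}"
      using card_above_less[OF fin mem, of g] i by simp
    then have "?L (insert d T) = ?L T \<circ> ?s (Suc g)"
      using less.hyps[OF _ rec T] less.prems(5) i by simp
    moreover have "?C T \<circ> ?s g = ?s (Suc g) \<circ> ?C T"
      using word_perm_upt_shift[OF i(2) h] by (simp add: column_word_def)
    then have "?s (Suc g) \<circ> (?C T \<circ> ?R T) = ?C T \<circ> (?s g \<circ> ?R T)"
      by (metis comp_assoc)
    ultimately show ?thesis by (simp add: split same commute comp_assoc)
  qed
qed

section \<open>From single slides to whole words\<close>

text \<open>Each slide contributes one factor on the right. The inclusion of shapes is carried along
  so that the bound \<open>n\<close> on the final shape also bounds every intermediate
  diagram.\<close>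

lemma word_perm_tower_word_record_from:
  assumes "record_from R k w = Some R'" "\<forall>a\<in>set w. 1 \<le> a" "tower_diagram (shape R)"
    and "\<forall>c\<in>shape R'. fst c < n"
  shows "shape R \<subseteq> shape R' \<and>
    word_perm (tower_word (shape R') 1 n) = word_perm (tower_word (shape R) 1 n) \<circ> word_perm w"
  using assms
proof (induction w arbitrary: R k)
  case (Cons a w)
  obtain d where d: "slide_from (shape R) a 1 = Some d"
      "record_from (R(d \<mapsto> k)) (k + 1) w = Some R'"
    using Cons.prems(1) by (auto simp: slide_def split: option.splits)
  have shape: "shape (R(d \<mapsto> k)) = insert d (shape R)" by (simp add: shape_def)
  have "tower_diagram (insert d (shape R))"
    using slide_from_tower_diagram[OF d(1) Cons.prems(3)] Cons.prems(2) by simp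
  with Cons.IH[OF d(2), unfolded shape] Cons.prems(2,4)
  have IH: "insert d (shape R) \<subseteq> shape R'"
    "word_perm (tower_word (shape R') 1 n) =
     word_perm (tower_word (insert d (shape R)) 1 n) \<circ> word_perm w"
    by (simp_all add: comp_def)
  then have "\<forall>c\<in>insert d (shape R). fst c < n" using Cons.prems(4) by blast
  with word_perm_tower_word_slide_from[OF d(1) Cons.prems(3)] Cons.prems(2) IH
  show ?case by (simp add: comp_assoc)
qed simp

lemma word_perm_eq_tower_word:
  assumes "recording_tableau w = Some R" "\<forall>a\<in>set w. 1 \<le> a" "\<forall>c\<in>shape R. fst c < n"
  shows "word_perm w = word_perm (tower_word (shape R) 1 n)"
proof -
  have empty: "shape Map.empty = {}" by (simp add: shape_def)
  have "tower_word {} 1 n = []"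
    by (simp add: tower_word_def column_word_def height_def)
  moreover have "tower_diagram (shape Map.empty)" by (simp add: empty tower_diagram_def)
  ultimately show ?thesis
    using word_perm_tower_word_record_from[of Map.empty 1 w R n] assms
    by (simp add: recording_tableau_def empty)
qed

theorem theorem4p2:
  fixes \<alpha> \<beta> :: "nat list" and n :: nat and P Q :: tableau
  assumes "length \<alpha> = n" and "length \<beta> = n"
    and "\<forall>a\<in>set \<alpha>. 1 \<le> a" and "\<forall>b\<in>set \<beta>. 1 \<le> b"
    and "recording_tableau \<alpha> = Some P" and "recording_tableau \<beta> = Some Q"
    and "shape P = shape Q"
  shows "word_perm \<alpha> = word_perm \<beta>"
proof -
  have "finite (fst ` shape P)"
    using tower_diagram_shape[OF assms(5,3)] by (simp add: tower_diagram_def)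
  \<comment> \<open>As the shapes agree, one \<open>N\<close> beyond all occupied columns serves
    both words, and both permutations are spelled by the same \<open>tower_word\<close>.\<close>
  then obtain N where "\<forall>c\<in>shape P. fst c < N"
    using finite_nat_set_iff_bounded by auto
  then show ?thesis
    using word_perm_eq_tower_word[OF assms(5,3)] word_perm_eq_tower_word[OF assms(6,4)] assms(7)
    by metis
qed

end
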